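(* Let $n\ge 2$ and let $\varphi$ be any non-negative weight function on the transpositions of $[n]=\{1,\dots,n\}$. For all permutations $\pi,\sigma\in\mathbb{S}_n$, \[ \tfrac12\, D(\pi,\sigma)\;\le\; \mathsf{d}_\varphi(\pi,\sigma)\;\le\; 2\,D(\pi,\sigma), \qquad\text{where}\quad D(\pi,\sigma)=\sum_{i=1}^n \mathrm{weight}\bigl(p^*(\pi^{-1}(i),\sigma^{-1}(i))\bigr). \]
   Context: $\mathbb{S}_n$ is the symmetric group on $[n]$; a permutation $\pi$ is viewed as a ranking, with $\pi(k)$ the candidate in position $k$ and $\pi^{-1}(i)$ the position of candidate $i$. A transposition $(a\ b)$, $a\neq b\in[n]$, acts on a permutation by swapping the elements in positions $a$ and $b$. Let $\Theta$ be the set of all transpositions, and let $\varphi:\Theta\to\mathbb{R}^+$ be a non-negative weight function, $\varphi(a,b)$ denoting the weight of $(a\ b)$ (so $\varphi(a,b)=\varphi(b,a)$). The weighted transposition distance $\mathsf{d}_\varphi(\pi,\sigma)$ is the minimum total weight of a sequence of transpositions transforming $\pi$ into $\sigma$. Let $\mathcal{H}$ be the complete undirected graph on vertex set $[n]$ in which edge $\{i,j\}$ has weight $\varphi(i,j)$; $p^*(i,j)$ denotes a minimum-weight path between $i$ and $j$ in $\mathcal{H}$ and $\mathrm{weight}(p^*(i,j))$ its total weight (equal to $0$ when $i=j$). *)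

theory Defs
  imports
    Complex_Main
    "HOL-Combinatorics.Permutations"
    "Graph_Theory.Kuratowski"
    "Graph_Theory.Shortest_Path"
begin

section \<open>Weighted transposition distance\<close>

text \<open>
  Permutations of \<open>[n]\<close> are functions with \<open>p permutes {1..n}\<close>. A weight function is a function
  on permutations of which only the values on \<open>transpositions n\<close> matter; the weight
  \<open>\<phi>(a, b)\<close> is \<open>\<phi> (transpose a b)\<close>, which is symmetric in \<open>a\<close> and \<open>b\<close> by construction.
\<close>

definition transpositions :: "nat \<Rightarrow> (nat \<Rightarrow> nat) set" where
  "transpositions n = {transpose a b | a b. a \<in> {1..n} \<and> b \<in> {1..n} \<and> a \<noteq> b}"

text \<open>
  A transposition acts on positions: \<open>\<pi> \<circ> transpose a b\<close> is \<open>\<pi>\<close> with the entries in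
  positions \<open>a\<close> and \<open>b\<close> swapped. The head of the list acts first.
\<close>

definition apply_transpositions ::
    "(nat \<Rightarrow> nat) \<Rightarrow> (nat \<Rightarrow> nat) list \<Rightarrow> nat \<Rightarrow> nat" where
  "apply_transpositions \<pi> ts = foldl (\<circ>) \<pi> ts"

definition transforms ::
    "nat \<Rightarrow> (nat \<Rightarrow> nat) list \<Rightarrow> (nat \<Rightarrow> nat) \<Rightarrow> (nat \<Rightarrow> nat) \<Rightarrow> bool" where
  "transforms n ts \<pi> \<sigma> \<longleftrightarrow> set ts \<subseteq> transpositions n \<and> apply_transpositions \<pi> ts = \<sigma>"

text \<open>That this minimum exists is shown below (\<open>wt_dist_attained\<close>, \<open>wt_dist_le\<close>).\<close>

definition wt_dist ::
    "nat \<Rightarrow> ((nat \<Rightarrow> nat) \<Rightarrow> real) \<Rightarrow> (nat \<Rightarrow> nat) \<Rightarrow> (nat \<Rightarrow> nat) \<Rightarrow> real" where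
  "wt_dist n \<phi> \<pi> \<sigma> = (LEAST w. \<exists>ts. transforms n ts \<pi> \<sigma> \<and> w = sum_list (map \<phi> ts))"

section \<open>Minimum-weight paths in the complete graph\<close>

text \<open>An undirected edge is represented by its two orientations, which carry the same weight.\<close>

definition complete_graph :: "nat \<Rightarrow> nat pair_pre_digraph" where
  "complete_graph n = \<lparr>pverts = {1..n}, parcs = {(i, j). i \<in> {1..n} \<and> j \<in> {1..n} \<and> i \<noteq> j}\<rparr>"

lemma K_complete_graph: "K\<^bsub>n\<^esub> (with_proj (complete_graph n))"
  unfolding complete_digraph_pair_def by (auto simp: complete_graph_def)

definition is_path :: "nat \<Rightarrow> nat \<Rightarrow> (nat \<times> nat) awalk \<Rightarrow> nat \<Rightarrow> bool" where
  "is_path n i p j \<longleftrightarrow> pre_digraph.apath (with_proj (complete_graph n)) i p j"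

definition path_weight :: "((nat \<Rightarrow> nat) \<Rightarrow> real) \<Rightarrow> (nat \<times> nat) awalk \<Rightarrow> real" where
  "path_weight \<phi> p = wf_digraph.awalk_cost (\<lambda>(a, b). \<phi> (transpose a b)) p"

definition min_path :: "nat \<Rightarrow> ((nat \<Rightarrow> nat) \<Rightarrow> real) \<Rightarrow> nat \<Rightarrow> nat \<Rightarrow> (nat \<times> nat) awalk" where
  "min_path n \<phi> i j = arg_min (path_weight \<phi>) (\<lambda>p. is_path n i p j)"

definition D_dist ::
    "nat \<Rightarrow> ((nat \<Rightarrow> nat) \<Rightarrow> real) \<Rightarrow> (nat \<Rightarrow> nat) \<Rightarrow> (nat \<Rightarrow> nat) \<Rightarrow> real" where
  "D_dist n \<phi> \<pi> \<sigma> = (\<Sum>i = 1..n. path_weight \<phi> (min_path n \<phi> (inv \<pi> i) (inv \<sigma> i)))"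

section \<open>The minima exist\<close>

interpretation complete_graph: pair_graph "complete_graph n" for n
  by (rule pair_graphI_complete[OF K_complete_graph])

lemma path_weight_eq: "path_weight \<phi> p = (\<Sum>(a, b)\<leftarrow>p. \<phi> (transpose a b))"
  unfolding path_weight_def by (simp add: complete_graph.awalk_cost_def)

lemma ex_path:
  assumes "i \<in> {1..n}" "j \<in> {1..n}"
  shows "\<exists>p. is_path n i p j"
proof (cases "i = j")
  case True
  then have "is_path n i [] j"
    using assms unfolding is_path_def complete_graph.apath_def complete_graph.awalk_def
    by (simp add: complete_graph_def)
  then show ?thesis ..
next
  case False
  then have "is_path n i [(i, j)] j"
    using assms unfolding is_path_def complete_graph.apath_def complete_graph.awalk_def
    by (simp add: complete_graph_def)
  then show ?thesis ..
qed

lemma finite_paths: "finite {p. is_path n i p j}"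
  unfolding is_path_def by (rule complete_graph.apaths_finite)

lemma min_path_is_arg_min:
  assumes "i \<in> {1..n}" "j \<in> {1..n}"
  shows "is_arg_min (path_weight \<phi>) (\<lambda>p. is_path n i p j) (min_path n \<phi> i j)"
proof -
  have "\<exists>p. is_arg_min (path_weight \<phi>) (\<lambda>p. p \<in> {p. is_path n i p j}) p"
    by (rule ex_is_arg_min_if_finite) (use finite_paths ex_path[OF assms] in auto)
  then show ?thesis
    unfolding min_path_def arg_min_def by (auto intro: someI_ex)
qed

lemma transposition_permutes: "t \<in> transpositions n \<Longrightarrow> t permutes {1..n}"
  unfolding transpositions_def by (auto intro: permutes_swap_id)

lemma apply_transpositions_Nil [simp]: "apply_transpositions \<pi> [] = \<pi>"
  by (simp add: apply_transpositions_def)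

lemma apply_transpositions_append [simp]:
  "apply_transpositions \<pi> (xs @ ys) = apply_transpositions (apply_transpositions \<pi> xs) ys"
  by (simp add: apply_transpositions_def)

lemma apply_transpositions_permutes:
  assumes "set ts \<subseteq> transpositions n" "\<pi> permutes {1..n}"
  shows "apply_transpositions \<pi> ts permutes {1..n}"
  using assms(1)
proof (induction ts rule: rev_induct)
  case Nil
  then show ?case using assms(2) by simp
next
  case (snoc t ts)
  then have "(apply_transpositions \<pi> ts \<circ> t) permutes {1..n}"
    using permutes_compose[OF transposition_permutes] by auto
  then show ?case unfolding apply_transpositions_def by (simp only: foldl_append foldl.simps)
qed

lemma ex_transforms:
  assumes "\<pi> permutes {1..n}" "\<sigma> permutes {1..n}"
  shows "\<exists>ts. transforms n ts \<pi> \<sigma>"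
proof -
  have "\<exists>ts. transforms n ts \<pi> (\<pi> \<circ> p)" if "p permutes {1..n}" for p
    using finite_atLeastAtMost that
  proof (induction p rule: permutes_rev_induct)
    case id
    have "transforms n [] \<pi> (\<pi> \<circ> id)" by (simp add: transforms_def)
    then show ?case ..
  next
    case (swap a b p)
    then obtain ts where "transforms n ts \<pi> (\<pi> \<circ> p)" by blast
    moreover have "transpose a b \<in> transpositions n"
      using swap.hyps by (auto simp: transpositions_def)
    ultimately have "transforms n (ts @ [transpose a b]) \<pi> (\<pi> \<circ> (p \<circ> transpose a b))"
      by (simp add: transforms_def apply_transpositions_def comp_assoc)
    then show ?case ..
  qed
  moreover have "(inv \<pi> \<circ> \<sigma>) permutes {1..n}"
    using assms by (intro permutes_compose permutes_inv)
  moreover have "\<pi> \<circ> (inv \<pi> \<circ> \<sigma>) = \<sigma>"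
    using permutes_inv_o(1)[OF assms(1)] by (simp add: comp_assoc[symmetric])
  ultimately show ?thesis by metis
qed

lemma transforms_short:
  assumes nonneg: "\<forall>\<tau> \<in> transpositions n. 0 \<le> \<phi> \<tau>"
    and \<pi>: "\<pi> permutes {1..n}"
    and "transforms n ts \<pi> \<sigma>"
  shows "\<exists>ts'. transforms n ts' \<pi> \<sigma> \<and> length ts' \<le> card {p. p permutes {1..n}} \<and>
           sum_list (map \<phi> ts') \<le> (sum_list (map \<phi> ts) :: real)"
  using assms(3)
proof (induction "length ts" arbitrary: ts rule: less_induct)
  case less
  let ?P = "{p. p permutes {1..n}}"
  let ?f = "\<lambda>k. apply_transpositions \<pi> (take k ts)"
  show ?case
  proof (cases "length ts \<le> card ?P")
    case True
    then show ?thesis using less.prems by blast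
  next
    case False
    have sub: "set ts \<subseteq> transpositions n" using less.prems by (simp add: transforms_def)
    have "?f ` {0..length ts} \<subseteq> ?P"
      using apply_transpositions_permutes[OF _ \<pi>] sub set_take_subset by fastforce
    then have "card (?f ` {0..length ts}) \<le> card ?P"
      by (intro card_mono finite_permutations) auto
    then have "\<not> inj_on ?f {0..length ts}"
      using False by (intro pigeonhole) simp
    then obtain i j where ij: "i < j" "j \<le> length ts" "?f i = ?f j"
      unfolding inj_on_def by (metis atLeastAtMost_iff linorder_neqE_nat)
    let ?ts = "take i ts @ drop j ts"
    have split: "ts = take i ts @ drop i (take j ts) @ drop j ts"
      using ij(1) by (metis append.assoc append_take_drop_id less_imp_le min.absorb1 take_take)
    have "apply_transpositions \<pi> ?ts = apply_transpositions \<pi> (take j ts @ drop j ts)"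
      using ij(3) by (simp del: append_take_drop_id)
    then have tr: "transforms n ?ts \<pi> \<sigma>"
      using less.prems sub set_take_subset[of i ts] set_drop_subset[of j ts]
      by (auto simp: transforms_def simp del: apply_transpositions_append)
    have "set (drop i (take j ts)) \<subseteq> transpositions n"
      using sub set_drop_subset set_take_subset by fastforce
    then have "0 \<le> sum_list (map \<phi> (drop i (take j ts)))"
      using nonneg by (intro sum_list_nonneg) auto
    moreover have "sum_list (map \<phi> ts) =
        sum_list (map \<phi> ?ts) + sum_list (map \<phi> (drop i (take j ts)))"
      by (subst split) simp
    ultimately have "sum_list (map \<phi> ?ts) \<le> sum_list (map \<phi> ts)" by linarith
    moreover have "length ?ts < length ts" using ij by simp
    ultimately show ?thesis using less.hyps[OF _ tr] by force
  qed
qed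

lemma wt_dist_minimum:
  assumes nonneg: "\<forall>\<tau> \<in> transpositions n. 0 \<le> \<phi> \<tau>"
    and "\<pi> permutes {1..n}" "\<sigma> permutes {1..n}"
  shows "(\<exists>ts. transforms n ts \<pi> \<sigma> \<and> wt_dist n \<phi> \<pi> \<sigma> = sum_list (map \<phi> ts)) \<and>
         (\<forall>ts. transforms n ts \<pi> \<sigma> \<longrightarrow> wt_dist n \<phi> \<pi> \<sigma> \<le> sum_list (map \<phi> ts))"
proof -
  let ?w = "\<lambda>ts. sum_list (map \<phi> ts)"
  let ?S = "{ts. transforms n ts \<pi> \<sigma> \<and> length ts \<le> card {p. p permutes {1..n}}}"
  have "transpositions n \<subseteq> {p. p permutes {1..n}}" using transposition_permutes by blast
  then have "finite (transpositions n)"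
    using finite_permutations[of "{1..n}"] by (auto intro: finite_subset)
  then have "finite {ts. set ts \<subseteq> transpositions n \<and> length ts \<le> card {p. p permutes {1..n}}}"
    by (rule finite_lists_length_le)
  then have fin: "finite ?S" by (rule rev_finite_subset) (auto simp: transforms_def)
  have "?S \<noteq> {}"
    using ex_transforms[OF assms(2,3)] transforms_short[OF assms(1,2)] by blast
  then obtain t where t: "t \<in> ?S" "\<And>s. s \<in> ?S \<Longrightarrow> ?w t \<le> ?w s"
    using ex_is_arg_min_if_finite[OF fin, of ?w] by (auto simp: is_arg_min_linorder)
  have min: "?w t \<le> ?w s" if "transforms n s \<pi> \<sigma>" for s
    using transforms_short[OF assms(1,2) that] t(2) by fastforce
  have "wt_dist n \<phi> \<pi> \<sigma> = ?w t"
    unfolding wt_dist_def by (rule Least_equality) (use t(1) min in auto)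
  then show ?thesis using t(1) min by auto
qed

lemmas wt_dist_attained = wt_dist_minimum[THEN conjunct1]
lemmas wt_dist_le = wt_dist_minimum[THEN conjunct2, rule_format]

end

theory Submission
  imports Defs
begin

text \<open>
  Let \<open>d\<close> be the minimum path weight between positions; it satisfies the triangle inequality and
  \<open>d a b \<le> \<phi> (transpose a b)\<close>. Lower bound: a transposition moves only two candidates, so it
  changes \<open>D\<close> by at most twice its weight.
  Upper bound: conjugating along a path, the entries in positions \<open>x\<close> and \<open>y\<close> can be swapped at
  cost at most \<open>2 * d x y\<close>. Put \<open>\<rho> = inv \<sigma> \<circ> \<pi>\<close>, so that the entry in position \<open>p\<close> has to move to
  position \<open>\<rho> p\<close>. A cycle of \<open>\<rho>\<close> is sorted by keeping one of its entries ``wandering'': if it sits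
  in position \<open>x\<close>, swap it with the entry in position \<open>y = inv \<rho> x\<close>. The latter then is in place,
  and the wandering entry is in position \<open>y\<close> with its destination unchanged. In this way the
  entries other than the wandering one pay for exactly their own distance.
\<close>

section \<open>The minimum path weight\<close>

definition path_dist :: "nat \<Rightarrow> ((nat \<Rightarrow> nat) \<Rightarrow> real) \<Rightarrow> nat \<Rightarrow> nat \<Rightarrow> real" where
  "path_dist n \<phi> i j = path_weight \<phi> (min_path n \<phi> i j)"

lemma D_dist_eq: "D_dist n \<phi> \<pi> \<sigma> = (\<Sum>i = 1..n. path_dist n \<phi> (inv \<pi> i) (inv \<sigma> i))"
  by (simp add: D_dist_def path_dist_def)

lemma path_weight_Nil [simp]: "path_weight \<phi> [] = 0"
  and path_weight_Cons [simp]: "path_weight \<phi> ((a, b) # p) = \<phi> (transpose a b) + path_weight \<phi> p"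
  and path_weight_append [simp]: "path_weight \<phi> (p @ q) = path_weight \<phi> p + path_weight \<phi> q"
  by (simp_all add: path_weight_eq)

lemma awalk_Nil: "complete_graph.awalk n i [] j \<longleftrightarrow> i = j \<and> i \<in> {1..n}"
  and awalk_Cons: "complete_graph.awalk n i ((a, b) # p) j \<longleftrightarrow>
    i = a \<and> a \<in> {1..n} \<and> b \<in> {1..n} \<and> a \<noteq> b \<and> complete_graph.awalk n b p j"
  unfolding complete_graph.awalk_simps by (auto simp: complete_graph_def)

lemma awalk_min_path:
  assumes "i \<in> {1..n}" "j \<in> {1..n}"
  shows "complete_graph.awalk n i (min_path n \<phi> i j) j"
  using min_path_is_arg_min[OF assms, of \<phi>]
  by (auto simp: is_arg_min_def is_path_def intro: complete_graph.awalkI_apath)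

lemma transpose_in_transpositions:
  "\<lbrakk>a \<in> {1..n}; b \<in> {1..n}; a \<noteq> b\<rbrakk> \<Longrightarrow> transpose a b \<in> transpositions n"
  by (auto simp: transpositions_def)

context
  fixes n :: nat and \<phi> :: "(nat \<Rightarrow> nat) \<Rightarrow> real"
  assumes nonneg: "\<forall>\<tau> \<in> transpositions n. 0 \<le> \<phi> \<tau>"
begin

lemma awalk_cost_nonneg:
  assumes "complete_graph.awalk n u p v"
  shows "0 \<le> path_weight \<phi> p"
  unfolding path_weight_def
  by (rule complete_graph.pos_cost_pos_awalk_cost[OF assms])
    (use nonneg in \<open>auto simp: complete_graph_def intro!: bspec[OF nonneg] transpose_in_transpositions\<close>)

text \<open>The minimum ranges over simple paths only. A walk shortens to such a path by deleting
  cycles, which cannot raise the cost because no closed walk has negative weight. Concatenated paths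
  can therefore be used to bound \<open>path_dist\<close>.\<close>

lemma path_dist_le_walk:
  assumes p: "complete_graph.awalk n i p j"
  shows "path_dist n \<phi> i j \<le> path_weight \<phi> p"
proof -
  let ?q = "complete_graph.awalk_to_apath n p"
  have ends: "i \<in> {1..n}" "j \<in> {1..n}"
    using complete_graph.awalk_hd_in_verts[OF p] complete_graph.awalk_last_in_verts[OF p]
    by (auto simp: complete_graph_def)
  have "is_path n i ?q j"
    unfolding is_path_def by (rule complete_graph.apath_awalk_to_apath[OF p])
  then have "path_dist n \<phi> i j \<le> path_weight \<phi> ?q"
    using min_path_is_arg_min[OF ends, of \<phi>] by (auto simp: path_dist_def is_arg_min_linorder)
  also have "\<dots> \<le> path_weight \<phi> p"
    unfolding path_weight_def
    by (rule complete_graph.awalk_to_path_no_neg_cyc_cost[OF p])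
      (use awalk_cost_nonneg in \<open>auto simp: path_weight_def not_less\<close>)
  finally show ?thesis .
qed

lemma path_dist_nonneg:
  assumes "i \<in> {1..n}" "j \<in> {1..n}"
  shows "0 \<le> path_dist n \<phi> i j"
  unfolding path_dist_def by (rule awalk_cost_nonneg[OF awalk_min_path[OF assms]])

lemma path_dist_refl:
  assumes "i \<in> {1..n}"
  shows "path_dist n \<phi> i i = 0"
proof -
  have "complete_graph.awalk n i [] i"
    using assms by (simp add: awalk_Nil)
  from path_dist_le_walk[OF this] show ?thesis
    using path_dist_nonneg[OF assms assms] by simp
qed

lemma path_dist_le_weight:
  assumes "i \<in> {1..n}" "j \<in> {1..n}" "i \<noteq> j"
  shows "path_dist n \<phi> i j \<le> \<phi> (transpose i j)"
proof -
  have "complete_graph.awalk n i [(i, j)] j"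
    using assms by (simp add: awalk_Nil awalk_Cons)
  from path_dist_le_walk[OF this] show ?thesis by simp
qed

lemma path_dist_triangle:
  assumes "i \<in> {1..n}" "j \<in> {1..n}" "k \<in> {1..n}"
  shows "path_dist n \<phi> i k \<le> path_dist n \<phi> i j + path_dist n \<phi> j k"
proof -
  have "complete_graph.awalk n i (min_path n \<phi> i j @ min_path n \<phi> j k) k"
    by (rule complete_graph.awalk_appendI) (rule awalk_min_path; fact)+
  from path_dist_le_walk[OF this] show ?thesis by (simp add: path_dist_def)
qed

section \<open>Lower bound\<close>

lemma D_dist_comp_transposition:
  assumes \<pi>: "\<pi> permutes {1..n}" and \<sigma>: "\<sigma> permutes {1..n}" and t: "t \<in> transpositions n"
  shows "D_dist n \<phi> \<pi> (\<sigma> \<circ> t) \<le> D_dist n \<phi> \<pi> \<sigma> + 2 * \<phi> t"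
proof -
  obtain a b where ab: "t = transpose a b" "a \<in> {1..n}" "b \<in> {1..n}" "a \<noteq> b"
    using t by (auto simp: transpositions_def)
  \<comment> \<open>\<open>?e v\<close> is the charge to the candidate in position \<open>v\<close>
    of \<sigma>: only those in positions \<open>a\<close> and \<open>b\<close> move, each across a
    single edge.\<close>
  let ?e = "\<lambda>v. if v \<in> {a, b} then \<phi> t else 0"
  have inv: "inv (\<sigma> \<circ> t) i = t (inv \<sigma> i)" for i
    using o_inv_distrib[of \<sigma> t] permutes_bij[OF \<sigma>] ab(1) by simp
  have step: "path_dist n \<phi> u (t v) \<le> path_dist n \<phi> u v + ?e v"
    if uv: "u \<in> {1..n}" "v \<in> {1..n}" for u v
  proof (cases "v \<in> {a, b}")
    case True
    then have tv: "t v \<in> {1..n}" "v \<noteq> t v" "transpose v (t v) = t"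
      using ab by (auto simp: transpose_commute)
    show ?thesis
      using path_dist_triangle[OF uv tv(1)] path_dist_le_weight[OF uv(2) tv(1,2)] True tv(3) by auto
  next
    case False
    then show ?thesis using ab(1) by (auto simp: transpose_def)
  qed
  have "D_dist n \<phi> \<pi> (\<sigma> \<circ> t) \<le> (\<Sum>i = 1..n. path_dist n \<phi> (inv \<pi> i) (inv \<sigma> i) + ?e (inv \<sigma> i))"
    unfolding D_dist_eq inv
    by (intro sum_mono step) (simp_all only: permutes_in_image[OF permutes_inv] \<pi> \<sigma>)
  also have "\<dots> = D_dist n \<phi> \<pi> \<sigma> + (\<Sum>i = 1..n. ?e (inv \<sigma> i))"
    by (simp add: D_dist_eq sum.distrib)
  \<comment> \<open>Summing over positions in \<sigma> instead of candidates shows that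
    \<open>a\<close> and \<open>b\<close> contribute exactly once each.\<close>
  also have "(\<Sum>i = 1..n. ?e (inv \<sigma> i)) = (\<Sum>v = 1..n. ?e v)"
    using sum.permute[OF permutes_inv[OF \<sigma>], of ?e] by (simp add: comp_def)
  also have "\<dots> = (\<Sum>v \<in> {a, b}. \<phi> t)"
    using ab by (intro sum.mono_neutral_cong_right) auto
  also have "\<dots> = 2 * \<phi> t" using ab(4) by simp
  finally show ?thesis .
qed

text \<open>From \<pi> to itself the distance is 0, and each appended transposition adds at most
  twice its weight.\<close>

lemma D_dist_apply_transpositions:
  assumes "\<pi> permutes {1..n}" "set ts \<subseteq> transpositions n"
  shows "D_dist n \<phi> \<pi> (apply_transpositions \<pi> ts) \<le> 2 * sum_list (map \<phi> ts)"
  using assms(2)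
proof (induction ts rule: rev_induct)
  case Nil
  have "inv \<pi> i \<in> {1..n}" if "i \<in> {1..n}" for i
    using that permutes_in_image[OF permutes_inv[OF assms(1)]] by blast
  then show ?case by (simp add: D_dist_eq path_dist_refl)
next
  case (snoc t ts)
  have "apply_transpositions \<pi> ts permutes {1..n}"
    using snoc.prems by (intro apply_transpositions_permutes assms(1)) simp
  then have "D_dist n \<phi> \<pi> (apply_transpositions \<pi> ts \<circ> t)
      \<le> D_dist n \<phi> \<pi> (apply_transpositions \<pi> ts) + 2 * \<phi> t"
    using snoc.prems by (intro D_dist_comp_transposition assms(1)) simp_all
  also have "apply_transpositions \<pi> ts \<circ> t = apply_transpositions \<pi> (ts @ [t])"
    by (simp only: apply_transpositions_def foldl_append foldl.simps)
  finally have "D_dist n \<phi> \<pi> (apply_transpositions \<pi> (ts @ [t]))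
      \<le> D_dist n \<phi> \<pi> (apply_transpositions \<pi> ts) + 2 * \<phi> t" .
  moreover have "D_dist n \<phi> \<pi> (apply_transpositions \<pi> ts) \<le> 2 * sum_list (map \<phi> ts)"
    using snoc by simp
  ultimately show ?case by (simp del: apply_transpositions_append)
qed

section \<open>Upper bound\<close>

lemma transforms_trans:
  "\<lbrakk>transforms n ts \<pi> \<rho>; transforms n us \<rho> \<sigma>\<rbrakk> \<Longrightarrow> transforms n (ts @ us) \<pi> \<sigma>"
  by (auto simp: transforms_def)

text \<open>Transpositions act on the right, so they commute with relabelling the candidates on the
  left. This reduces transforming \<pi> into \<sigma> to sorting
  \<open>inv \<sigma> \<circ> \<pi>\<close>.\<close>

lemma transforms_comp_left:
  assumes "transforms n ts \<pi> \<sigma>"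
  shows "transforms n ts (\<rho> \<circ> \<pi>) (\<rho> \<circ> \<sigma>)"
proof -
  have "foldl (\<circ>) (\<rho> \<circ> \<pi>) ts = \<rho> \<circ> foldl (\<circ>) \<pi> ts"
    by (induction ts arbitrary: \<pi>) (simp_all add: comp_assoc)
  then show ?thesis using assms by (simp add: transforms_def apply_transpositions_def)
qed

lemma transforms_transpose:
  assumes "a \<in> {1..n}" "b \<in> {1..n}" "a \<noteq> b"
  shows "transforms n [transpose a b] \<pi> (\<pi> \<circ> transpose a b)"
  using transpose_in_transpositions[OF assms] by (simp add: transforms_def apply_transpositions_def)

text \<open>The first edge \<open>(x, z)\<close> is used before and after a recursive swap of
  \<open>z\<close> and \<open>y\<close>, so no step of the walk is paid for more than twice. The
  recursive swap starts from \<open>\<pi> \<circ> transpose x z\<close>, hence the generalisation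
  over \<pi>.\<close>

lemma swap_along_walk:
  assumes "complete_graph.awalk n x p y"
  shows "\<exists>ts. transforms n ts \<pi> (\<pi> \<circ> transpose x y) \<and> sum_list (map \<phi> ts) \<le> 2 * path_weight \<phi> p"
  using assms
proof (induction p arbitrary: x \<pi>)
  case Nil
  then have "x = y" by (simp add: awalk_Nil)
  then show ?case by (intro exI[of _ "[]"]) (simp add: transforms_def)
next
  case (Cons e p)
  then obtain z where e: "e = (x, z)" "x \<in> {1..n}" "z \<in> {1..n}" "x \<noteq> z"
    and p: "complete_graph.awalk n z p y"
    by (cases e) (simp add: awalk_Cons)
  note xz = transforms_transpose[OF e(2-4)]
  have w: "0 \<le> \<phi> (transpose x z)"
    using nonneg transpose_in_transpositions[OF e(2-4)] by blast
  have wp: "0 \<le> path_weight \<phi> p" by (rule awalk_cost_nonneg[OF p])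
  consider "y = x" | "y = z" | "y \<noteq> x" "y \<noteq> z" by blast
  then show ?case
  proof cases
    case 1
    then show ?thesis using w wp e(1)
      by (intro exI[of _ "[]"]) (simp add: transforms_def)
  next
    case 2
    have "sum_list (map \<phi> [transpose x z]) \<le> 2 * path_weight \<phi> (e # p)"
      using w wp e(1) by simp
    then show ?thesis using xz[of \<pi>] 2 by blast
  next
    case 3
    obtain ts where ts: "transforms n ts (\<pi> \<circ> transpose x z) (\<pi> \<circ> transpose x z \<circ> transpose z y)"
      "sum_list (map \<phi> ts) \<le> 2 * path_weight \<phi> p"
      using Cons.IH[OF p] by blast
    have conj: "transpose x z \<circ> transpose z y \<circ> transpose x z = transpose x y"
      using 3 e(4) by (auto simp: fun_eq_iff transpose_def)
    have "transforms n ([transpose x z] @ ts @ [transpose x z]) \<pi>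
        (\<pi> \<circ> transpose x z \<circ> transpose z y \<circ> transpose x z)"
      by (intro transforms_trans[OF xz] transforms_trans[OF ts(1)] xz)
    then have "transforms n ([transpose x z] @ ts @ [transpose x z]) \<pi> (\<pi> \<circ> transpose x y)"
      using conj by (simp add: comp_assoc)
    moreover have "sum_list (map \<phi> ([transpose x z] @ ts @ [transpose x z])) \<le>
        2 * path_weight \<phi> (e # p)"
      using ts(2) e(1) by simp
    ultimately show ?thesis by blast
  qed
qed

lemma swap_cost:
  assumes "x \<in> {1..n}" "y \<in> {1..n}"
  shows "\<exists>ts. transforms n ts \<pi> (\<pi> \<circ> transpose x y) \<and>
           sum_list (map \<phi> ts) \<le> 2 * path_dist n \<phi> x y"
  unfolding path_dist_def by (rule swap_along_walk[OF awalk_min_path[OF assms]])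

text \<open>Here \<open>x\<close> is the position of the wandering entry, which does not contribute to the bound.\<close>

lemma sort_cost:
  assumes "\<rho> permutes {1..n}" "x \<in> {1..n}"
  shows "\<exists>ts. transforms n ts \<rho> id \<and>
           sum_list (map \<phi> ts) \<le> 2 * (\<Sum>p \<in> {1..n} - {x}. path_dist n \<phi> p (\<rho> p))"
  using assms
proof (induction "card {p. \<rho> p \<noteq> p}" arbitrary: \<rho> x rule: less_induct)
  case less
  note \<rho> = less.prems(1)
  let ?S = "\<lambda>\<rho> A. \<Sum>p \<in> A. path_dist n \<phi> p (\<rho> p)"
  have in_range: "\<rho> p \<in> {1..n}" if "p \<in> {1..n}" for p
    using that permutes_in_image[OF \<rho>] by blast
  \<comment> \<open>This is the swap step within a cycle; a fixed \<open>x\<close> is reduced to it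
    below.\<close>
  have moved: "\<exists>ts. transforms n ts \<rho> id \<and> sum_list (map \<phi> ts) \<le> 2 * ?S \<rho> ({1..n} - {x})"
    if x: "\<rho> x \<noteq> x" for x
  proof -
    define y where "y = inv \<rho> x"
    have \<rho>y: "\<rho> y = x" unfolding y_def by (rule permutes_inverses(1)[OF \<rho>])
    have "y \<noteq> x" using \<rho>y x by auto
    have xn: "x \<in> {1..n}" using x \<rho> by (auto simp: permutes_def)
    have yn: "y \<in> {1..n}" using xn \<rho>y permutes_in_image[OF \<rho>] by blast
    define \<rho>' where "\<rho>' = \<rho> \<circ> transpose y x"
    have \<rho>': "\<rho>' permutes {1..n}"
      unfolding \<rho>'_def using \<rho> xn yn by (intro permutes_compose permutes_swap_id)
    have vals: "\<rho>' x = x" "\<rho>' y = \<rho> x" "\<And>p. p \<noteq> x \<Longrightarrow> p \<noteq> y \<Longrightarrow> \<rho>' p = \<rho> p"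
      by (simp_all add: \<rho>'_def \<rho>y)
    \<comment> \<open>\<open>x\<close> becomes fixed, \<open>y\<close> was not fixed before, and all
      other values are unchanged.\<close>
    have "{p. \<rho>' p \<noteq> p} \<subset> {p. \<rho> p \<noteq> p}"
      using vals x \<rho>y \<open>y \<noteq> x\<close> by (smt (verit) Collect_mono_iff mem_Collect_eq psubsetI)
    moreover have "finite {p. \<rho> p \<noteq> p}"
      by (rule finite_subset[of _ "{1..n}"]) (use \<rho> in \<open>auto simp: permutes_def\<close>)
    ultimately have "card {p. \<rho>' p \<noteq> p} < card {p. \<rho> p \<noteq> p}" by (rule psubset_card_mono[rotated])
    \<comment> \<open>The wandering entry now sits in \<open>y\<close>, so the bound for
      \<open>\<rho>'\<close> omits the term of \<open>y\<close>. In the bound for \<rho> that term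
      is \<open>path_dist n \<phi> y x\<close>, which pays for the swap.\<close>
    from less.hyps[OF this \<rho>' yn] obtain us where us: "transforms n us \<rho>' id"
      "sum_list (map \<phi> us) \<le> 2 * ?S \<rho>' ({1..n} - {y})" by blast
    obtain ts where ts: "transforms n ts \<rho> \<rho>'" "sum_list (map \<phi> ts) \<le> 2 * path_dist n \<phi> y x"
      unfolding \<rho>'_def using swap_cost[OF yn xn] by blast
    have swap: "{1..n} - {y} - {x} = {1..n} - {x} - {y}" by blast
    have "?S \<rho>' ({1..n} - {y}) = path_dist n \<phi> x (\<rho>' x) + ?S \<rho>' ({1..n} - {y} - {x})"
      by (rule sum.remove) (use xn \<open>y \<noteq> x\<close> in auto)
    also have "\<dots> = ?S \<rho>' ({1..n} - {x} - {y})"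
      by (simp only: vals(1) path_dist_refl[OF xn] swap add_0)
    also have "\<dots> = ?S \<rho> ({1..n} - {x} - {y})"
      by (rule sum.cong) (use vals(3) in auto)
    finally have "?S \<rho>' ({1..n} - {y}) = ?S \<rho> ({1..n} - {x} - {y})" .
    moreover have "?S \<rho> ({1..n} - {x}) = path_dist n \<phi> y (\<rho> y) + ?S \<rho> ({1..n} - {x} - {y})"
      by (rule sum.remove) (use yn \<open>y \<noteq> x\<close> in auto)
    ultimately have "sum_list (map \<phi> (ts @ us)) \<le> 2 * ?S \<rho> ({1..n} - {x})"
      using us(2) ts(2) \<rho>y by simp
    then show ?thesis using transforms_trans[OF ts(1) us(1)] by blast
  qed
  show ?case
  proof (cases "\<rho> = id")
    case True
    then have "transforms n [] \<rho> id" by (simp add: transforms_def)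
    moreover have "0 \<le> ?S \<rho> ({1..n} - {x})"
      by (intro sum_nonneg path_dist_nonneg in_range) auto
    ultimately show ?thesis by (intro exI[of _ "[]"]) simp
  next
    case False
    show ?thesis
    proof (cases "\<rho> x = x")
      case True
      \<comment> \<open>With \<open>x\<close> in place, a nontrivial cycle is entered at any unfixed
        \<open>x'\<close>. Restoring the nonnegative term of \<open>x'\<close> only weakens the
        bound, and the term of \<open>x\<close> is 0.\<close>
      obtain x' where "\<rho> x' \<noteq> x'" using \<open>\<rho> \<noteq> id\<close> by (auto simp: fun_eq_iff)
      then obtain ts where ts: "transforms n ts \<rho> id"
        "sum_list (map \<phi> ts) \<le> 2 * ?S \<rho> ({1..n} - {x'})"
        using moved by blast
      have "?S \<rho> ({1..n} - {x'}) \<le> ?S \<rho> {1..n}"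
        by (intro sum_mono2 path_dist_nonneg in_range) auto
      also have "\<dots> = path_dist n \<phi> x (\<rho> x) + ?S \<rho> ({1..n} - {x})"
        by (rule sum.remove) (use less.prems(2) in auto)
      also have "\<dots> = ?S \<rho> ({1..n} - {x})"
        using True path_dist_refl[OF less.prems(2)] by simp
      finally show ?thesis using ts by (intro exI[of _ ts]) simp
    qed (rule moved)
  qed
qed

text \<open>The candidate \<open>\<pi> p\<close> occupies position \<open>p\<close> in \<pi>, so
  indexing by \<open>p\<close> expresses \<open>D_dist\<close> as the total displacement that
  \<open>sort_cost\<close> bounds against.\<close>

lemma D_dist_eq_displacement:
  assumes \<pi>: "\<pi> permutes {1..n}"
  shows "D_dist n \<phi> \<pi> \<sigma> = (\<Sum>p = 1..n. path_dist n \<phi> p ((inv \<sigma> \<circ> \<pi>) p))"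
  unfolding D_dist_eq using permutes_inverses(2)[OF \<pi>]
  by (subst sum.permute[OF \<pi>]) (simp add: comp_def)

lemma transform_cost:
  assumes "1 \<le> n" and \<pi>: "\<pi> permutes {1..n}" and \<sigma>: "\<sigma> permutes {1..n}"
  shows "\<exists>ts. transforms n ts \<pi> \<sigma> \<and> sum_list (map \<phi> ts) \<le> 2 * D_dist n \<phi> \<pi> \<sigma>"
proof -
  let ?\<rho> = "inv \<sigma> \<circ> \<pi>"
  have \<rho>: "?\<rho> permutes {1..n}" using \<pi> \<sigma> by (intro permutes_compose permutes_inv)
  \<comment> \<open>Position 1 is an arbitrary start for the wandering entry, available since
    \<open>1 \<le> n\<close>.\<close>
  obtain ts where ts: "transforms n ts ?\<rho> id"
    "sum_list (map \<phi> ts) \<le> 2 * (\<Sum>p \<in> {1..n} - {1}. path_dist n \<phi> p (?\<rho> p))"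
    using sort_cost[OF \<rho>, of 1] assms(1) by auto
  have "\<sigma> \<circ> ?\<rho> = \<pi>" using permutes_inv_o(1)[OF \<sigma>] by (simp add: comp_assoc[symmetric])
  then have "transforms n ts \<pi> \<sigma>" using transforms_comp_left[OF ts(1), of \<sigma>] by simp
  moreover have "(\<Sum>p \<in> {1..n} - {1}. path_dist n \<phi> p (?\<rho> p)) \<le> D_dist n \<phi> \<pi> \<sigma>"
    unfolding D_dist_eq_displacement[OF \<pi>]
  proof (intro sum_mono2 path_dist_nonneg)
    show "?\<rho> p \<in> {1..n}" if "p \<in> {1..n} - ({1..n} - {1})" for p
      using that permutes_in_image[OF \<rho>] by blast
  qed auto
  ultimately show ?thesis using ts(2) by (intro exI[of _ ts]) simp
qed

end

theorem mainTheorem1: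
  fixes n :: nat
    and \<phi> :: "(nat \<Rightarrow> nat) \<Rightarrow> real"
    and \<pi> \<sigma> :: "nat \<Rightarrow> nat"
  assumes "n \<ge> 2"
    and "\<forall>\<tau> \<in> transpositions n. \<phi> \<tau> \<ge> 0"
    and "\<pi> permutes {1..n}"
    and "\<sigma> permutes {1..n}"
  shows "1/2 * D_dist n \<phi> \<pi> \<sigma> \<le> wt_dist n \<phi> \<pi> \<sigma>
       \<and> wt_dist n \<phi> \<pi> \<sigma> \<le> 2 * D_dist n \<phi> \<pi> \<sigma>"
proof
  \<comment> \<open>The bound for every sequence passes to \<open>wt_dist\<close> through one that
    attains the minimum.\<close>
  obtain ts where ts: "transforms n ts \<pi> \<sigma>" "wt_dist n \<phi> \<pi> \<sigma> = sum_list (map \<phi> ts)"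
    using wt_dist_attained[OF assms(2-4)] by blast
  then show "1/2 * D_dist n \<phi> \<pi> \<sigma> \<le> wt_dist n \<phi> \<pi> \<sigma>"
    using D_dist_apply_transpositions[OF assms(2,3), of ts] by (simp add: transforms_def)
next
  obtain us where "transforms n us \<pi> \<sigma>" "sum_list (map \<phi> us) \<le> 2 * D_dist n \<phi> \<pi> \<sigma>"
    using transform_cost[OF assms(2) _ assms(3,4)] assms(1) by auto
  then show "wt_dist n \<phi> \<pi> \<sigma> \<le> 2 * D_dist n \<phi> \<pi> \<sigma>"
    using wt_dist_le[OF bspec[OF assms(2)] assms(3,4)] by force
qed

end
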